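(* If $\Psi=\Psi(s,t)$ is a solution of the Betchov-Da Rios equation $\Psi_t=\Psi_s\times\Psi_{ss}\times\Psi_{sss}$ in $E^4$ (with unit speed $s$-parameter curves), then, according to the parallel transport frame field, the mean curvature vector field of the soliton surface $\Psi=\Psi(s,t)$ is $$\vec{H}=\frac{1}{2Q^2\mathcal{W}^4}\Big(\big((Sk_2-Rk_3)\mathcal{B}+\mathcal{W}^2k_1(Q^2\mathcal{W}^2+\mathcal{A})\big)\mathcal{P}_1+\big((-Sk_1+Pk_3)\mathcal{B}+\mathcal{W}^2k_2(Q^2\mathcal{W}^2+\mathcal{A})\big)\mathcal{P}_2+\big((Rk_1-Pk_2)\mathcal{B}+\mathcal{W}^2k_3(Q^2\mathcal{W}^2+\mathcal{A})\big)\mathcal{P}_3\Big).$$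
   Context: Setting. $E^4$ is $\mathbb{R}^4$ with its standard inner product $\langle\cdot,\cdot\rangle$ and orientation; the ternary vector product $x\times y\times z$ is the formal determinant of the $4\times4$ matrix whose first row is the standard basis $(e_1,e_2,e_3,e_4)$ and whose remaining rows are $x,y,z$. Subscripts $s,t$ denote partial derivatives. $\Psi=\Psi(s,t)$ is a smooth map from a product of two open intervals to $E^4$ whose $s$-parameter curves $s\mapsto\Psi(s,t)$ are unit speed for all $t$. A parallel transport frame field is a smooth positively oriented orthonormal frame $\{\mathcal{T},\mathcal{P}_1,\mathcal{P}_2,\mathcal{P}_3\}$ along $\Psi$ with $\mathcal{T}=\Psi_s$, $\mathcal{T}_s=k_1\mathcal{P}_1+k_2\mathcal{P}_2+k_3\mathcal{P}_3$ and $(\mathcal{P}_i)_s=-k_i\mathcal{T}$; $k_1,k_2,k_3$ are its curvature functions. Put $\mathfrak{a}_{23}=\langle(\mathcal{P}_1)_t,\mathcal{P}_2\rangle$, $\mathfrak{a}_{24}=\langle(\mathcal{P}_1)_t,\mathcal{P}_3\rangle$, $\mathfrak{a}_{34}=\langle(\mathcal{P}_2)_t,\mathcal{P}_3\rangle$, $P=k_3(k_2)_s-k_2(k_3)_s$, $R=k_1(k_3)_s-k_3(k_1)_s$, $S=k_2(k_1)_s-k_1(k_2)_s$, $Q=\sqrt{k_1^2+k_2^2+k_3^2}$, $\mathcal{W}=\sqrt{P^2+R^2+S^2}$, and $\mathcal{A}=(Pk_3-Sk_1)\mathfrak{a}_{24}+(Pk_2-Rk_1)\mathfrak{a}_{23}+(Rk_3-Sk_2)\mathfrak{a}_{34}-R(k_2)_t-S(k_3)_t-P(k_1)_t$,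 $\mathcal{B}=\mathcal{W}^2(k_1\mathfrak{a}_{34}-k_2\mathfrak{a}_{24}+k_3\mathfrak{a}_{23})+S(k_2P_t-k_1R_t)+R(k_1S_t-k_3P_t)+P(k_3R_t-k_2S_t)$. Standing assumptions: at least two of $k_1,k_2,k_3$ are non-zero, and $P,R,S$ are not all zero at any point. The mean curvature vector field is $\vec{H}=\tfrac12\big(\operatorname{tr}(A_{N_1})N_1+\operatorname{tr}(A_{N_2})N_2\big)$, where $A_{N_1},A_{N_2}$ are the shape operators with respect to an orthonormal frame $N_1,N_2$ of the normal bundle. *)

theory Defs
  imports "HOL-Analysis.Analysis"
begin

unbundle no cross3_syntax
unbundle set_product_syntax

text \<open>Maps of two real parameters are curried. The partial derivatives are meant to be used on a
  product of two open sets, where they only depend on the values of the map there.\<close>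

definition pd_s :: "(real \<Rightarrow> real \<Rightarrow> 'a::real_normed_vector) \<Rightarrow> real \<Rightarrow> real \<Rightarrow> 'a"
  where "pd_s f s t = vector_derivative (\<lambda>x. f x t) (at s)"

definition pd_t :: "(real \<Rightarrow> real \<Rightarrow> 'a::real_normed_vector) \<Rightarrow> real \<Rightarrow> real \<Rightarrow> 'a"
  where "pd_t f s t = vector_derivative (\<lambda>y. f s y) (at t)"

text \<open>Class \<open>C\<^sup>n\<close>: all partial derivatives of order at most \<open>n\<close> exist, and those of order exactly
  \<open>n\<close> are jointly continuous (which forces joint continuity of the lower ones).\<close>

primrec C_on :: "nat \<Rightarrow> real set \<Rightarrow> real set \<Rightarrow> (real \<Rightarrow> real \<Rightarrow> 'a::real_normed_vector) \<Rightarrow> bool"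
  where
    "C_on 0 I J f \<longleftrightarrow> continuous_on (I \<times> J) (\<lambda>(s, t). f s t)"
  | "C_on (Suc n) I J f \<longleftrightarrow>
      (\<forall>s\<in>I. \<forall>t\<in>J. (\<lambda>x. f x t) differentiable at s \<and> (\<lambda>y. f s y) differentiable at t) \<and>
      C_on n I J (pd_s f) \<and> C_on n I J (pd_t f)"

definition smooth_on :: "real set \<Rightarrow> real set \<Rightarrow> (real \<Rightarrow> real \<Rightarrow> 'a::real_normed_vector) \<Rightarrow> bool"
  where "smooth_on I J f \<longleftrightarrow> (\<forall>n. C_on n I J f)"

text \<open>The formal determinant with first row \<open>(e\<^sub>1, e\<^sub>2, e\<^sub>3, e\<^sub>4)\<close> is linear in that row, so its
  \<open>i\<close>-th component is the determinant whose first row is the numerical vector \<open>e\<^sub>i\<close>.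
  In particular \<open>e\<^sub>1, e\<^sub>2, e\<^sub>3\<close> have the product \<open>- e\<^sub>4\<close>.\<close>

definition ternary_product :: "real^4 \<Rightarrow> real^4 \<Rightarrow> real^4 \<Rightarrow> real^4"
  where "ternary_product x y z = (\<chi> i. det (vector [axis i 1, x, y, z] :: real^4^4))"

definition parallel_transport_frame ::
  "real set \<Rightarrow> real set \<Rightarrow> (real \<Rightarrow> real \<Rightarrow> real^4) \<Rightarrow> (real \<Rightarrow> real \<Rightarrow> real^4) \<Rightarrow>
   (real \<Rightarrow> real \<Rightarrow> real^4) \<Rightarrow> (real \<Rightarrow> real \<Rightarrow> real^4) \<Rightarrow> (real \<Rightarrow> real \<Rightarrow> real^4) \<Rightarrow>
   (real \<Rightarrow> real \<Rightarrow> real) \<Rightarrow> (real \<Rightarrow> real \<Rightarrow> real) \<Rightarrow> (real \<Rightarrow> real \<Rightarrow> real) \<Rightarrow> bool"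
  where
  "parallel_transport_frame I J \<Psi> T P1 P2 P3 k1 k2 k3 \<longleftrightarrow>
     smooth_on I J T \<and> smooth_on I J P1 \<and> smooth_on I J P2 \<and> smooth_on I J P3 \<and>
     (\<forall>s\<in>I. \<forall>t\<in>J.
        norm (T s t) = 1 \<and> norm (P1 s t) = 1 \<and> norm (P2 s t) = 1 \<and> norm (P3 s t) = 1 \<and>
        orthogonal (T s t) (P1 s t) \<and> orthogonal (T s t) (P2 s t) \<and> orthogonal (T s t) (P3 s t) \<and>
        orthogonal (P1 s t) (P2 s t) \<and> orthogonal (P1 s t) (P3 s t) \<and> orthogonal (P2 s t) (P3 s t) \<and>
        det (vector [T s t, P1 s t, P2 s t, P3 s t] :: real^4^4) > 0 \<and>
        T s t = pd_s \<Psi> s t \<and>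
        pd_s T s t = k1 s t *\<^sub>R P1 s t + k2 s t *\<^sub>R P2 s t + k3 s t *\<^sub>R P3 s t \<and>
        pd_s P1 s t = - k1 s t *\<^sub>R T s t \<and>
        pd_s P2 s t = - k2 s t *\<^sub>R T s t \<and>
        pd_s P3 s t = - k3 s t *\<^sub>R T s t)"

definition tangent_plane :: "(real \<Rightarrow> real \<Rightarrow> 'a::euclidean_space) \<Rightarrow> real \<Rightarrow> real \<Rightarrow> 'a set"
  where "tangent_plane \<Psi> s t = span {pd_s \<Psi> s t, pd_t \<Psi> s t}"

definition orthonormal_normal_frame ::
  "real set \<Rightarrow> real set \<Rightarrow> (real \<Rightarrow> real \<Rightarrow> real^4) \<Rightarrow>
   (real \<Rightarrow> real \<Rightarrow> real^4) \<Rightarrow> (real \<Rightarrow> real \<Rightarrow> real^4) \<Rightarrow> bool"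
  where
  "orthonormal_normal_frame I J \<Psi> N1 N2 \<longleftrightarrow>
     smooth_on I J N1 \<and> smooth_on I J N2 \<and>
     (\<forall>s\<in>I. \<forall>t\<in>J.
        norm (N1 s t) = 1 \<and> norm (N2 s t) = 1 \<and> orthogonal (N1 s t) (N2 s t) \<and>
        (\<forall>v\<in>tangent_plane \<Psi> s t. orthogonal (N1 s t) v \<and> orthogonal (N2 s t) v))"

definition orth_proj :: "'a::euclidean_space set \<Rightarrow> 'a \<Rightarrow> 'a"
  where "orth_proj V x = (THE y. y \<in> V \<and> (\<forall>v\<in>V. orthogonal (x - y) v))"

text \<open>Weingarten formula: the shape operator sends a tangent vector \<open>v\<close> to minus the tangential
  part of the derivative of the normal field \<open>N\<close> in direction \<open>v\<close>. As \<open>N\<close> is a field along \<open>\<Psi>\<close>,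
  that derivative is \<open>a N\<^sub>s + b N\<^sub>t\<close> for \<open>v = a \<Psi>\<^sub>s + b \<Psi>\<^sub>t\<close>. The value is well determined for
  \<open>v\<close> in the tangent plane where \<open>\<Psi>\<close> is an immersion.\<close>

definition shape_operator ::
  "(real \<Rightarrow> real \<Rightarrow> 'a::euclidean_space) \<Rightarrow> (real \<Rightarrow> real \<Rightarrow> 'a) \<Rightarrow> real \<Rightarrow> real \<Rightarrow> 'a \<Rightarrow> 'a"
  where
  "shape_operator \<Psi> N s t v =
     (THE w. \<exists>a b. v = a *\<^sub>R pd_s \<Psi> s t + b *\<^sub>R pd_t \<Psi> s t \<and>
        w = - orth_proj (tangent_plane \<Psi> s t) (a *\<^sub>R pd_s N s t + b *\<^sub>R pd_t N s t))"

text \<open>Trace of an endomorphism \<open>f\<close> of the finite-dimensional subspace \<open>V\<close>; the choice of basis is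
  immaterial.\<close>

definition trace_on :: "'a::euclidean_space set \<Rightarrow> ('a \<Rightarrow> 'a) \<Rightarrow> real"
  where
  "trace_on V f =
     (let B = (SOME B. independent B \<and> span B = V) in \<Sum>b\<in>B. representation B (f b) b)"

definition mean_curvature_vector ::
  "(real \<Rightarrow> real \<Rightarrow> 'a::euclidean_space) \<Rightarrow> (real \<Rightarrow> real \<Rightarrow> 'a) \<Rightarrow> (real \<Rightarrow> real \<Rightarrow> 'a) \<Rightarrow>
   real \<Rightarrow> real \<Rightarrow> 'a"
  where
  "mean_curvature_vector \<Psi> N1 N2 s t =
     (1/2) *\<^sub>R (trace_on (tangent_plane \<Psi> s t) (shape_operator \<Psi> N1 s t) *\<^sub>R N1 s t +
               trace_on (tangent_plane \<Psi> s t) (shape_operator \<Psi> N2 s t) *\<^sub>R N2 s t)"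

end

theory Submission
  imports Defs
begin

text \<open>
  By the transport equations \<open>\<Psi>\<^sub>s\<^sub>s = K\<close> with \<open>K = k\<^sub>1 P\<^sub>1 + k\<^sub>2 P\<^sub>2 + k\<^sub>3 P\<^sub>3\<close>, and evaluating the
  ternary product in the frame gives \<open>\<Psi>\<^sub>t = P P\<^sub>1 + R P\<^sub>2 + S P\<^sub>3\<close>, which is orthogonal to \<open>\<Psi>\<^sub>s\<close> and
  \<open>K\<close> and has norm \<open>W \<noteq> 0\<close>. Differentiating \<open>N \<bullet> \<Psi>\<^sub>s = 0\<close> and \<open>N \<bullet> \<Psi>\<^sub>t = 0\<close> shows that the shape
  operator of a normal field \<open>N\<close> has trace \<open>X \<bullet> N\<close> with \<open>X = K + \<Psi>\<^sub>t\<^sub>t / W\<^sup>2\<close>; hence \<open>2 H\<close> is the normal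
  part of \<open>X\<close>. It is computed in the orthogonal normal frame consisting of \<open>K\<close> and
  \<open>n = K \<times> \<Psi>\<^sub>t\<close> (cross product in the span of \<open>P\<^sub>1, P\<^sub>2, P\<^sub>3\<close>), where \<open>K \<bullet> K = Q\<^sup>2\<close>,
  \<open>n \<bullet> n = Q\<^sup>2 W\<^sup>2\<close>, \<open>\<Psi>\<^sub>t\<^sub>t \<bullet> K = A\<close> and \<open>\<Psi>\<^sub>t\<^sub>t \<bullet> n = B\<close>.
\<close>

section \<open>Determinants and orthonormal expansions in dimension four\<close>

lemma vector_4 [simp]:
  "(vector [w, x, y, z] :: 'a::zero^4) $ 1 = w"
  "(vector [w, x, y, z] :: 'a::zero^4) $ 2 = x"
  "(vector [w, x, y, z] :: 'a::zero^4) $ 3 = y"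
  "(vector [w, x, y, z] :: 'a::zero^4) $ 4 = z"
  by (simp_all add: vector_def)

text \<open>Splitting off the images of 1, 2 and 3 in turn writes every permutation as a product of
  transpositions with known sign; the 24 terms are grouped as the cofactor expansion along the first
  row.\<close>

lemma det_4:
  "det (A :: 'a::comm_ring_1^4^4) =
    A$1$1 * (A$2$2 * (A$3$3 * A$4$4 - A$3$4 * A$4$3) - A$2$3 * (A$3$2 * A$4$4 - A$3$4 * A$4$2)
           + A$2$4 * (A$3$2 * A$4$3 - A$3$3 * A$4$2))
  - A$1$2 * (A$2$1 * (A$3$3 * A$4$4 - A$3$4 * A$4$3) - A$2$3 * (A$3$1 * A$4$4 - A$3$4 * A$4$1)
           + A$2$4 * (A$3$1 * A$4$3 - A$3$3 * A$4$1))
  + A$1$3 * (A$2$1 * (A$3$2 * A$4$4 - A$3$4 * A$4$2) - A$2$2 * (A$3$1 * A$4$4 - A$3$4 * A$4$1)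
           + A$2$4 * (A$3$1 * A$4$2 - A$3$2 * A$4$1))
  - A$1$4 * (A$2$1 * (A$3$2 * A$4$3 - A$3$3 * A$4$2) - A$2$2 * (A$3$1 * A$4$3 - A$3$3 * A$4$1)
           + A$2$3 * (A$3$1 * A$4$2 - A$3$2 * A$4$1))"
proof -
  have f1: "finite {2::4, 3, 4}" "1 \<notin> {2::4, 3, 4}"
    and f2: "finite {3::4, 4}" "2 \<notin> {3::4, 4}"
    and f3: "finite {4::4}" "3 \<notin> {4::4}"
    by auto
  show ?thesis
    unfolding det_def UNIV_4 sum_over_permutations_insert[OF f1]
      sum_over_permutations_insert[OF f2] sum_over_permutations_insert[OF f3] permutes_sing
    by (simp add: sign_swap_id permutation_swap_id sign_compose sign_id swap_id_eq
        permutation_compose algebra_simps)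
qed

lemma orthonormal_expand_4:
  fixes e1 e2 e3 e4 x :: "real^4"
  assumes norms: "norm e1 = 1" "norm e2 = 1" "norm e3 = 1" "norm e4 = 1"
    and orth: "orthogonal e1 e2" "orthogonal e1 e3" "orthogonal e1 e4"
      "orthogonal e2 e3" "orthogonal e2 e4" "orthogonal e3 e4"
  shows "x = (x \<bullet> e1) *\<^sub>R e1 + (x \<bullet> e2) *\<^sub>R e2 + (x \<bullet> e3) *\<^sub>R e3 + (x \<bullet> e4) *\<^sub>R e4"
proof -
  let ?B = "{e1, e2, e3, e4}"
  have neq: "e1 \<noteq> e2" "e1 \<noteq> e3" "e1 \<noteq> e4" "e2 \<noteq> e3" "e2 \<noteq> e4" "e3 \<noteq> e4"
    using norms orth by (auto simp: orthogonal_self)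
  have pw: "pairwise orthogonal ?B"
    using orth by (auto simp: pairwise_def orthogonal_commute)
  have "0 \<notin> ?B"
    using norms by auto
  then have "independent ?B"
    using pw pairwise_orthogonal_independent by blast
  \<comment> \<open>By \<open>neq\<close> the set has four elements, the dimension of the space, so
    independence already forces it to span.\<close>
  then have "UNIV \<subseteq> span ?B"
    using neq by (intro card_ge_dim_independent) auto
  then have "(\<Sum>i\<in>?B. (x \<bullet> i) *\<^sub>R i) = x"
    using norms by (intro orthonormal_basis_expand[OF pw]) auto
  then show ?thesis
    using neq by (simp add: add.assoc)
qed

section \<open>Traces, orthogonal projections and shape operators on a plane\<close>

lemma trace_on_span_orthogonal:
  fixes u v :: "'a::euclidean_space"
  assumes uv: "u \<noteq> 0" "v \<noteq> 0" "orthogonal u v"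
    and f: "\<And>a b. f (a *\<^sub>R u + b *\<^sub>R v) = a *\<^sub>R p + b *\<^sub>R q"
    and pq: "p \<in> span {u, v}" "q \<in> span {u, v}"
  shows "trace_on (span {u, v}) f = (p \<bullet> u) / (u \<bullet> u) + (q \<bullet> v) / (v \<bullet> v)"
proof -
  define B where "B = (SOME B. independent B \<and> span B = span {u, v})"
  have "\<exists>B. independent B \<and> span B = span {u, v}"
    by (metis basis_exists span_subspace subspace_span)
  then have "independent B \<and> span B = span {u, v}"
    unfolding B_def by (rule someI_ex)
  then have B: "independent B" "span B = span {u, v}"
    by auto
  \<comment> \<open>The basis \<open>B\<close> is an unspecified choice. Pairing the expansion of
    \<open>w\<close> in \<open>B\<close> with a fixed \<open>z\<close> gives a sum whose value no
    longer depends on it.\<close>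
  have rep: "(\<Sum>b\<in>B. representation B w b * (b \<bullet> z)) = w \<bullet> z" if "w \<in> span {u, v}" for w z
  proof -
    have "(\<Sum>b\<in>B. representation B w b *\<^sub>R b) = w"
      using B that by (intro real_vector.sum_representation_eq) (auto simp: independent_bound)
    then have "w \<bullet> z = (\<Sum>b\<in>B. representation B w b *\<^sub>R b) \<bullet> z"
      by simp
    then show ?thesis
      by (simp add: inner_sum_left)
  qed
  have expand: "b = ((b \<bullet> u) / (u \<bullet> u)) *\<^sub>R u + ((b \<bullet> v) / (v \<bullet> v)) *\<^sub>R v"
    if "b \<in> span {u, v}" for b
  proof -
    from that obtain c where "b - c *\<^sub>R u \<in> span {v}"
      unfolding span_insert[of u] by blast
    then obtain d where "b - c *\<^sub>R u = d *\<^sub>R v"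
      unfolding span_singleton by blast
    then have "b = c *\<^sub>R u + d *\<^sub>R v"
      by (metis add.commute diff_add_cancel)
    then show ?thesis
      using uv by (simp add: inner_add_right orthogonal_def inner_commute)
  qed
  \<comment> \<open>Splitting \<open>b\<close> along \<open>u\<close> and \<open>v\<close> expresses
    \<open>f b\<close> through \<open>p\<close> and \<open>q\<close>, so each diagonal coefficient
    becomes a combination of summands covered by \<open>rep\<close>.\<close>
  have fb: "representation B (f b) b =
      (representation B p b * (b \<bullet> u)) / (u \<bullet> u) + (representation B q b * (b \<bullet> v)) / (v \<bullet> v)"
    if "b \<in> B" for b
  proof -
    have "f b = ((b \<bullet> u) / (u \<bullet> u)) *\<^sub>R p + ((b \<bullet> v) / (v \<bullet> v)) *\<^sub>R q"
      using expand[of b] f that B by (metis span_base)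
    then show ?thesis
      using B pq by (simp add: real_vector.representation_add real_vector.representation_scale
          real_vector.span_scale mult.commute)
  qed
  have "trace_on (span {u, v}) f = (\<Sum>b\<in>B. representation B (f b) b)"
    by (simp add: trace_on_def B_def Let_def)
  also have "\<dots> = (\<Sum>b\<in>B. representation B p b * (b \<bullet> u)) / (u \<bullet> u)
      + (\<Sum>b\<in>B. representation B q b * (b \<bullet> v)) / (v \<bullet> v)"
    by (simp add: fb sum.distrib sum_divide_distrib)
  finally show ?thesis
    using rep pq by simp
qed

lemma orth_proj_span_orthogonal:
  fixes u v :: "'a::euclidean_space"
  assumes "u \<noteq> 0" "v \<noteq> 0" "orthogonal u v"
  shows "orth_proj (span {u, v}) x = ((x \<bullet> u) / (u \<bullet> u)) *\<^sub>R u + ((x \<bullet> v) / (v \<bullet> v)) *\<^sub>R v"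
    (is "_ = ?p")
  unfolding orth_proj_def
proof (rule the_equality)
  have p: "?p \<in> span {u, v}"
    by (intro span_add span_scale span_base) auto
  have "orthogonal (x - ?p) u" "orthogonal (x - ?p) v"
    using assms by (simp_all add: orthogonal_def inner_diff_right inner_add_right inner_commute)
  then have o: "orthogonal (x - ?p) w" if "w \<in> span {u, v}" for w
    using orthogonal_to_span[OF that] by blast
  then show "?p \<in> span {u, v} \<and> (\<forall>w\<in>span {u, v}. orthogonal (x - ?p) w)"
    using p by blast
  fix y
  assume y: "y \<in> span {u, v} \<and> (\<forall>w\<in>span {u, v}. orthogonal (x - y) w)"
  \<comment> \<open>The difference of two candidates lies in the plane, and both residuals are
    orthogonal to the plane; subtracting them shows that this difference is orthogonal to
    itself.\<close>
  then have d: "y - ?p \<in> span {u, v}"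
    using p span_diff by blast
  then have "(x - ?p) \<bullet> (y - ?p) = 0" "(x - y) \<bullet> (y - ?p) = 0"
    using o y unfolding orthogonal_def by blast+
  then have "(y - ?p) \<bullet> (y - ?p) = 0"
    by (simp only: inner_diff_left)
  then show "y = ?p"
    by simp
qed

text \<open>In the orthogonal tangent basis \<open>u\<close>, \<open>v\<close> the diagonal entries
  are the \<open>u\<close>-coefficient of the image of \<open>u\<close> and the
  \<open>v\<close>-coefficient of the image of \<open>v\<close>. The tangential projection does not
  change inner products with \<open>u\<close> and \<open>v\<close>, so it disappears from the
  result.\<close>

lemma trace_shape_operator:
  fixes \<Psi> N :: "real \<Rightarrow> real \<Rightarrow> 'a::euclidean_space"
  defines "u \<equiv> \<lambda>s t. pd_s \<Psi> s t" and "v \<equiv> \<lambda>s t. pd_t \<Psi> s t"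
  assumes uv: "u s t \<noteq> 0" "v s t \<noteq> 0" "orthogonal (u s t) (v s t)"
  shows "trace_on (tangent_plane \<Psi> s t) (shape_operator \<Psi> N s t) =
    - (pd_s N s t \<bullet> u s t) / (u s t \<bullet> u s t) - (pd_t N s t \<bullet> v s t) / (v s t \<bullet> v s t)"
proof -
  let ?u = "u s t" and ?v = "v s t"
  let ?pr = "\<lambda>x. ((x \<bullet> ?u) / (?u \<bullet> ?u)) *\<^sub>R ?u + ((x \<bullet> ?v) / (?v \<bullet> ?v)) *\<^sub>R ?v"
  have plane: "tangent_plane \<Psi> s t = span {?u, ?v}"
    by (simp add: tangent_plane_def u_def v_def)
  \<comment> \<open>Unique tangent coordinates are what makes the definite description in
    \<open>shape_operator\<close> denote a value.\<close>
  have unique: "a = c \<and> b = d" if "a *\<^sub>R ?u + b *\<^sub>R ?v = c *\<^sub>R ?u + d *\<^sub>R ?v" for a b c d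
  proof -
    have "(a *\<^sub>R ?u + b *\<^sub>R ?v) \<bullet> ?u = (c *\<^sub>R ?u + d *\<^sub>R ?v) \<bullet> ?u"
      "(a *\<^sub>R ?u + b *\<^sub>R ?v) \<bullet> ?v = (c *\<^sub>R ?u + d *\<^sub>R ?v) \<bullet> ?v"
      using that by simp_all
    then show ?thesis
      using uv by (simp add: inner_add_right orthogonal_def inner_commute)
  qed
  have f: "shape_operator \<Psi> N s t (a *\<^sub>R ?u + b *\<^sub>R ?v) =
      a *\<^sub>R - ?pr (pd_s N s t) + b *\<^sub>R - ?pr (pd_t N s t)" for a b
  proof -
    have "shape_operator \<Psi> N s t (a *\<^sub>R ?u + b *\<^sub>R ?v) = - ?pr (a *\<^sub>R pd_s N s t + b *\<^sub>R pd_t N s t)"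
      unfolding shape_operator_def plane orth_proj_span_orthogonal[OF uv]
      unfolding u_def[symmetric] v_def[symmetric]
      by (rule the_equality) (use unique in blast)+
    also have "\<dots> = a *\<^sub>R - ?pr (pd_s N s t) + b *\<^sub>R - ?pr (pd_t N s t)"
      by (simp add: inner_add_left algebra_simps add_divide_distrib)
    finally show ?thesis .
  qed
  have "- ?pr x \<in> span {?u, ?v}" for x
    by (intro span_neg span_add span_scale span_base) auto
  from trace_on_span_orthogonal[OF uv f this this] show ?thesis
    using uv unfolding plane by (simp add: inner_add_right inner_diff_right orthogonal_def inner_commute)
qed

section \<open>Partial derivatives of smooth maps\<close>

lemma smooth_on_pd:
  assumes "smooth_on I J f"
  shows "smooth_on I J (pd_s f)" "smooth_on I J (pd_t f)"
proof -
  have "C_on (Suc n) I J f" for n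
    using assms unfolding smooth_on_def by blast
  then show "smooth_on I J (pd_s f)" "smooth_on I J (pd_t f)"
    unfolding smooth_on_def C_on.simps by blast+
qed

lemma smooth_on_has_vector_derivative:
  assumes "smooth_on I J f" "s \<in> I" "t \<in> J"
  shows "((\<lambda>x. f x t) has_vector_derivative pd_s f s t) (at s)"
    and "((\<lambda>y. f s y) has_vector_derivative pd_t f s t) (at t)"
proof -
  have "C_on (Suc 0) I J f"
    using assms unfolding smooth_on_def by blast
  then have "(\<lambda>x. f x t) differentiable at s" "(\<lambda>y. f s y) differentiable at t"
    using assms by auto
  then show "((\<lambda>x. f x t) has_vector_derivative pd_s f s t) (at s)"
    and "((\<lambda>y. f s y) has_vector_derivative pd_t f s t) (at t)"
    unfolding pd_s_def pd_t_def vector_derivative_works by auto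
qed

lemma has_vector_derivative_inner:
  fixes f g :: "real \<Rightarrow> 'a::real_inner"
  assumes "(f has_vector_derivative f') (at x)" "(g has_vector_derivative g') (at x)"
  shows "((\<lambda>y. f y \<bullet> g y) has_vector_derivative f' \<bullet> g x + f x \<bullet> g') (at x)"
  using bounded_bilinear.has_vector_derivative[OF bounded_bilinear_inner assms]
  by (simp add: add.commute)

text \<open>The frame identities hold only over \<open>I\<close> and \<open>J\<close>; as
  \<open>I\<close> is open, \<open>f\<close> may be replaced there by an expression \<open>g\<close>
  whose derivative is known.\<close>

lemma pd_s_eqI:
  assumes "open I" "s \<in> I" "\<And>x. x \<in> I \<Longrightarrow> g x = f x t" "(g has_vector_derivative d) (at s)"
  shows "pd_s f s t = d"
  unfolding pd_s_def
  by (rule vector_derivative_at, rule has_vector_derivative_transform_within_open[OF assms(4,1,2,3)])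

section \<open>The ternary product and orthogonal frames\<close>

lemma inner_ternary_product:
  "w \<bullet> ternary_product x y z = det (vector [w, x, y, z] :: real^4^4)"
  unfolding ternary_product_def inner_vec_def sum_4 det_4 vector_4 vec_lambda_beta inner_real_def
  by (simp add: axis_def) (simp add: ring_distribs)

lemma orthogonal_expand_4:
  fixes e1 e2 e3 e4 x :: "real^4"
  assumes nz: "e1 \<noteq> 0" "e2 \<noteq> 0" "e3 \<noteq> 0" "e4 \<noteq> 0"
    and orth: "orthogonal e1 e2" "orthogonal e1 e3" "orthogonal e1 e4"
      "orthogonal e2 e3" "orthogonal e2 e4" "orthogonal e3 e4"
  shows "x = ((x \<bullet> e1) / (e1 \<bullet> e1)) *\<^sub>R e1 + ((x \<bullet> e2) / (e2 \<bullet> e2)) *\<^sub>R e2 +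
    ((x \<bullet> e3) / (e3 \<bullet> e3)) *\<^sub>R e3 + ((x \<bullet> e4) / (e4 \<bullet> e4)) *\<^sub>R e4"
proof -
  \<comment> \<open>Normalising reduces to the orthonormal case, the two factors
    \<open>1 / norm e\<close> combining to \<open>1 / (e \<bullet> e)\<close>. For
    \<open>e = 0\<close> both sides are 0.\<close>
  have "(x \<bullet> sgn e) *\<^sub>R sgn e = ((x \<bullet> e) / (e \<bullet> e)) *\<^sub>R e" for e
    by (simp add: sgn_div_norm power2_norm_eq_inner[symmetric] power2_eq_square divide_inverse
        mult.assoc mult.left_commute)
  moreover have "x = (x \<bullet> sgn e1) *\<^sub>R sgn e1 + (x \<bullet> sgn e2) *\<^sub>R sgn e2 +
      (x \<bullet> sgn e3) *\<^sub>R sgn e3 + (x \<bullet> sgn e4) *\<^sub>R sgn e4"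
    using nz orth by (intro orthonormal_expand_4) (auto simp: norm_sgn orthogonal_def sgn_div_norm)
  ultimately show ?thesis
    by simp
qed

text \<open>Either pair completes \<open>u\<close>, \<open>v\<close> to an orthogonal basis. The two
  expansions of \<open>x\<close> share their \<open>u\<close> and \<open>v\<close> terms, so the
  remainders agree. This allows an arbitrary orthonormal normal frame to be exchanged for an
  explicit orthogonal one.\<close>

lemma projection_orthogonal_complement:
  fixes u v a b c d x :: "real^4"
  assumes nz: "u \<noteq> 0" "v \<noteq> 0" "a \<noteq> 0" "b \<noteq> 0"
    and uv: "orthogonal u v"
    and ab: "orthogonal a b" "orthogonal u a" "orthogonal u b" "orthogonal v a" "orthogonal v b"
    and cd: "norm c = 1" "norm d = 1" "orthogonal c d" "orthogonal u c" "orthogonal u d"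
      "orthogonal v c" "orthogonal v d"
  shows "(x \<bullet> c) *\<^sub>R c + (x \<bullet> d) *\<^sub>R d =
    ((x \<bullet> a) / (a \<bullet> a)) *\<^sub>R a + ((x \<bullet> b) / (b \<bullet> b)) *\<^sub>R b"
proof -
  have "c \<bullet> c = 1" "d \<bullet> d = 1"
    using cd by (simp_all add: norm_eq_1)
  moreover have "c \<noteq> 0" "d \<noteq> 0"
    using cd by auto
  ultimately have cd_expand: "x = ((x \<bullet> u) / (u \<bullet> u)) *\<^sub>R u + ((x \<bullet> v) / (v \<bullet> v)) *\<^sub>R v +
      (x \<bullet> c) *\<^sub>R c + (x \<bullet> d) *\<^sub>R d"
    using orthogonal_expand_4[of u v c d x] nz uv cd by simp
  have ab_expand: "x = ((x \<bullet> u) / (u \<bullet> u)) *\<^sub>R u + ((x \<bullet> v) / (v \<bullet> v)) *\<^sub>R v +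
      ((x \<bullet> a) / (a \<bullet> a)) *\<^sub>R a + ((x \<bullet> b) / (b \<bullet> b)) *\<^sub>R b"
    using orthogonal_expand_4[of u v a b x] nz uv ab by simp
  show ?thesis
    using trans[OF cd_expand[symmetric] ab_expand] by (simp only: add.assoc add_left_cancel)
qed

lemma has_vector_derivative_locally_const:
  assumes "open J" "t \<in> J" "\<And>y. y \<in> J \<Longrightarrow> f y = c" "(f has_vector_derivative d) (at t)"
  shows "d = 0"
proof -
  have "((\<lambda>_. c) has_vector_derivative d) (at t)"
    by (rule has_vector_derivative_transform_within_open[OF assms(4,1,2,3)])
  then show ?thesis
    using has_vector_derivative_const vector_derivative_unique_at by blast
qed

text \<open>Right multiplication by \<open>transpose M\<close> replaces the rows of \<open>A\<close>
  by their coordinates in the rows of \<open>M\<close>. Orthonormality gives determinant 1 or -1 for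
  \<open>M\<close>, and positivity selects 1.\<close>

lemma det_orthonormal_coordinates:
  fixes A M :: "real^'n^'n"
  assumes orth: "\<And>i j. M $ i \<bullet> M $ j = (if i = j then 1 else 0)" and pos: "det M > 0"
  shows "det A = det (\<chi> i j. A $ i \<bullet> M $ j)"
proof -
  have mult: "B ** transpose M = (\<chi> i j. B $ i \<bullet> M $ j)" for B :: "real^'n^'n"
    by (simp add: vec_eq_iff matrix_matrix_mult_def transpose_def inner_vec_def)
  have "M ** transpose M = mat 1"
    unfolding mult orth by (simp add: mat_def)
  then have "det M * det M = 1"
    by (metis det_I det_mul det_transpose)
  with pos have "det M = 1"
    by (simp add: square_eq_1_iff)
  then show ?thesis
    by (metis det_mul det_transpose mult mult.right_neutral)
qed

text \<open>In frame coordinates the row of \<open>e1\<close> is a unit vector, which eliminates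
  \<open>z1\<close> and leaves minus the cross product of \<open>(y2, y3, y4)\<close> and
  \<open>(z2, z3, z4)\<close>. The minus sign comes from the basis row standing above the row of
  \<open>e1\<close>.\<close>

lemma inner_ternary_product_frame:
  fixes e1 e2 e3 e4 :: "real^4"
  assumes norms: "norm e1 = 1" "norm e2 = 1" "norm e3 = 1" "norm e4 = 1"
    and orth: "orthogonal e1 e2" "orthogonal e1 e3" "orthogonal e1 e4"
      "orthogonal e2 e3" "orthogonal e2 e4" "orthogonal e3 e4"
    and pos: "det (vector [e1, e2, e3, e4] :: real^4^4) > 0"
    and y: "y = y2 *\<^sub>R e2 + y3 *\<^sub>R e3 + y4 *\<^sub>R e4"
    and z: "z = z1 *\<^sub>R e1 + z2 *\<^sub>R e2 + z3 *\<^sub>R e3 + z4 *\<^sub>R e4"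
  shows "e1 \<bullet> ternary_product e1 y z = 0"
    and "e2 \<bullet> ternary_product e1 y z = y4 * z3 - y3 * z4"
    and "e3 \<bullet> ternary_product e1 y z = y2 * z4 - y4 * z2"
    and "e4 \<bullet> ternary_product e1 y z = y3 * z2 - y2 * z3"
proof -
  let ?M = "vector [e1, e2, e3, e4] :: real^4^4"
  have ip: "e1 \<bullet> e1 = 1" "e2 \<bullet> e2 = 1" "e3 \<bullet> e3 = 1" "e4 \<bullet> e4 = 1"
    "e1 \<bullet> e2 = 0" "e1 \<bullet> e3 = 0" "e1 \<bullet> e4 = 0" "e2 \<bullet> e3 = 0" "e2 \<bullet> e4 = 0" "e3 \<bullet> e4 = 0"
    "e2 \<bullet> e1 = 0" "e3 \<bullet> e1 = 0" "e4 \<bullet> e1 = 0" "e3 \<bullet> e2 = 0" "e4 \<bullet> e2 = 0" "e4 \<bullet> e3 = 0"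
    using norms orth by (simp_all add: orthogonal_def norm_eq_1 inner_commute)
  have "?M $ i \<bullet> ?M $ j = (if i = j then 1 else 0)" for i j
    using exhaust_4[of i] exhaust_4[of j] ip by auto
  then have coords: "w \<bullet> ternary_product e1 y z = det (\<chi> i j. vector [w, e1, y, z] $ i \<bullet> ?M $ j)" for w
    unfolding inner_ternary_product by (rule det_orthonormal_coordinates[OF _ pos])
  show "e1 \<bullet> ternary_product e1 y z = 0"
    and "e2 \<bullet> ternary_product e1 y z = y4 * z3 - y3 * z4"
    and "e3 \<bullet> ternary_product e1 y z = y2 * z4 - y4 * z2"
    and "e4 \<bullet> ternary_product e1 y z = y3 * z2 - y2 * z3"
    unfolding coords
    unfolding det_4 vec_lambda_beta vector_4 y z inner_add_left inner_scaleR_left ip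
    by simp_all
qed

section \<open>Betchov-Da Rios surfaces: the velocity in the parallel transport frame\<close>

theorem theorem5:
  fixes I J :: "real set"
    and \<Psi> T P1 P2 P3 N1 N2 :: "real \<Rightarrow> real \<Rightarrow> real^4"
    and k1 k2 k3 a23 a24 a34 P R S Q W A B :: "real \<Rightarrow> real \<Rightarrow> real"
  assumes intervals: "open I" "is_interval I" "open J" "is_interval J"
    and smooth: "smooth_on I J \<Psi>"
    and unit_speed: "\<And>s t. s \<in> I \<Longrightarrow> t \<in> J \<Longrightarrow> norm (pd_s \<Psi> s t) = 1"
    and frame: "parallel_transport_frame I J \<Psi> T P1 P2 P3 k1 k2 k3"
    and a23: "a23 = (\<lambda>s t. pd_t P1 s t \<bullet> P2 s t)"
    and a24: "a24 = (\<lambda>s t. pd_t P1 s t \<bullet> P3 s t)"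
    and a34: "a34 = (\<lambda>s t. pd_t P2 s t \<bullet> P3 s t)"
    and P: "P = (\<lambda>s t. k3 s t * pd_s k2 s t - k2 s t * pd_s k3 s t)"
    and R: "R = (\<lambda>s t. k1 s t * pd_s k3 s t - k3 s t * pd_s k1 s t)"
    and S: "S = (\<lambda>s t. k2 s t * pd_s k1 s t - k1 s t * pd_s k2 s t)"
    and Q: "Q = (\<lambda>s t. sqrt ((k1 s t)^2 + (k2 s t)^2 + (k3 s t)^2))"
    and W: "W = (\<lambda>s t. sqrt ((P s t)^2 + (R s t)^2 + (S s t)^2))"
    and A: "A = (\<lambda>s t.
      (P s t * k3 s t - S s t * k1 s t) * a24 s t + (P s t * k2 s t - R s t * k1 s t) * a23 s t +
      (R s t * k3 s t - S s t * k2 s t) * a34 s t -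
      R s t * pd_t k2 s t - S s t * pd_t k3 s t - P s t * pd_t k1 s t)"
    and B: "B = (\<lambda>s t.
      (W s t)^2 * (k1 s t * a34 s t - k2 s t * a24 s t + k3 s t * a23 s t) +
      S s t * (k2 s t * pd_t P s t - k1 s t * pd_t R s t) +
      R s t * (k1 s t * pd_t S s t - k3 s t * pd_t P s t) +
      P s t * (k3 s t * pd_t R s t - k2 s t * pd_t S s t))"
    and two_nonzero:
      "((\<exists>s\<in>I. \<exists>t\<in>J. k1 s t \<noteq> 0) \<and> (\<exists>s\<in>I. \<exists>t\<in>J. k2 s t \<noteq> 0)) \<or>
       ((\<exists>s\<in>I. \<exists>t\<in>J. k1 s t \<noteq> 0) \<and> (\<exists>s\<in>I. \<exists>t\<in>J. k3 s t \<noteq> 0)) \<or>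
       ((\<exists>s\<in>I. \<exists>t\<in>J. k2 s t \<noteq> 0) \<and> (\<exists>s\<in>I. \<exists>t\<in>J. k3 s t \<noteq> 0))"
    and PRS: "\<And>s t. s \<in> I \<Longrightarrow> t \<in> J \<Longrightarrow> \<not> (P s t = 0 \<and> R s t = 0 \<and> S s t = 0)"
    and betchov_da_rios: "\<And>s t. s \<in> I \<Longrightarrow> t \<in> J \<Longrightarrow>
      pd_t \<Psi> s t = ternary_product (pd_s \<Psi> s t) (pd_s (pd_s \<Psi>) s t) (pd_s (pd_s (pd_s \<Psi>)) s t)"
    and normal_frame: "orthonormal_normal_frame I J \<Psi> N1 N2"
  shows "\<forall>s\<in>I. \<forall>t\<in>J. mean_curvature_vector \<Psi> N1 N2 s t =
    (1 / (2 * (Q s t)^2 * (W s t)^4)) *\<^sub>R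
      (((S s t * k2 s t - R s t * k3 s t) * B s t +
          (W s t)^2 * k1 s t * ((Q s t)^2 * (W s t)^2 + A s t)) *\<^sub>R P1 s t +
       ((- S s t * k1 s t + P s t * k3 s t) * B s t +
          (W s t)^2 * k2 s t * ((Q s t)^2 * (W s t)^2 + A s t)) *\<^sub>R P2 s t +
       ((R s t * k1 s t - P s t * k2 s t) * B s t +
          (W s t)^2 * k3 s t * ((Q s t)^2 * (W s t)^2 + A s t)) *\<^sub>R P3 s t)"
proof (intro ballI)
  fix s t
  assume st: "s \<in> I" "t \<in> J"
  note open_J = \<open>open J\<close> and open_I = \<open>open I\<close>
  have smooth_frame: "smooth_on I J T" "smooth_on I J P1" "smooth_on I J P2" "smooth_on I J P3"
    using frame by (auto simp: parallel_transport_frame_def)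
  have norms: "norm (T x y) = 1" "norm (P1 x y) = 1" "norm (P2 x y) = 1" "norm (P3 x y) = 1"
    and orth: "orthogonal (T x y) (P1 x y)" "orthogonal (T x y) (P2 x y)" "orthogonal (T x y) (P3 x y)"
      "orthogonal (P1 x y) (P2 x y)" "orthogonal (P1 x y) (P3 x y)" "orthogonal (P2 x y) (P3 x y)"
    and pos: "det (vector [T x y, P1 x y, P2 x y, P3 x y] :: real^4^4) > 0"
    and T: "T x y = pd_s \<Psi> x y"
    and T_s: "pd_s T x y = k1 x y *\<^sub>R P1 x y + k2 x y *\<^sub>R P2 x y + k3 x y *\<^sub>R P3 x y"
    and P_s: "pd_s P1 x y = - k1 x y *\<^sub>R T x y" "pd_s P2 x y = - k2 x y *\<^sub>R T x y"
      "pd_s P3 x y = - k3 x y *\<^sub>R T x y"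
    if "x \<in> I" "y \<in> J" for x y
    using frame that unfolding parallel_transport_frame_def by blast+
  have ip: "T x y \<bullet> T x y = 1" "P1 x y \<bullet> P1 x y = 1" "P2 x y \<bullet> P2 x y = 1" "P3 x y \<bullet> P3 x y = 1"
    "T x y \<bullet> P1 x y = 0" "T x y \<bullet> P2 x y = 0" "T x y \<bullet> P3 x y = 0"
    "P1 x y \<bullet> T x y = 0" "P2 x y \<bullet> T x y = 0" "P3 x y \<bullet> T x y = 0"
    "P1 x y \<bullet> P2 x y = 0" "P1 x y \<bullet> P3 x y = 0" "P2 x y \<bullet> P3 x y = 0"
    "P2 x y \<bullet> P1 x y = 0" "P3 x y \<bullet> P1 x y = 0" "P3 x y \<bullet> P2 x y = 0"
    if "x \<in> I" "y \<in> J" for x y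
    using norms[OF that] orth[OF that] by (simp_all add: orthogonal_def norm_eq_1 inner_commute)
  \<comment> \<open>Differentiability of the curvatures is obtained from these inner products of
    smooth fields.\<close>
  have k: "k1 x y = pd_s T x y \<bullet> P1 x y" "k2 x y = pd_s T x y \<bullet> P2 x y" "k3 x y = pd_s T x y \<bullet> P3 x y"
    if "x \<in> I" "y \<in> J" for x y
    by (simp_all add: T_s[OF that] inner_add_left ip[OF that])
  have \<Psi>_ss: "pd_s (pd_s \<Psi>) x y = pd_s T x y" if "x \<in> I" "y \<in> J" for x y
    by (rule pd_s_eqI[OF open_I that(1) _ smooth_on_has_vector_derivative(1)[OF smooth_frame(1) that]])
      (simp add: T that)
  have \<Psi>_sss: "pd_s (pd_s (pd_s \<Psi>)) x y = pd_s (pd_s T) x y" if "x \<in> I" "y \<in> J" for x y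
    by (rule pd_s_eqI[OF open_I that(1) _
          smooth_on_has_vector_derivative(1)[OF smooth_on_pd(1)[OF smooth_frame(1)] that]])
      (simp add: \<Psi>_ss that)
  \<comment> \<open>The second term of the product rule vanishes: the \<open>s\<close>-derivative of
    each \<open>Pi\<close> is a multiple of \<open>T\<close>, while \<open>pd_s T\<close> is
    orthogonal to \<open>T\<close>.\<close>
  have k_s: "pd_s k1 x y = pd_s (pd_s T) x y \<bullet> P1 x y" "pd_s k2 x y = pd_s (pd_s T) x y \<bullet> P2 x y"
    "pd_s k3 x y = pd_s (pd_s T) x y \<bullet> P3 x y"
    if "x \<in> I" "y \<in> J" for x y
  proof -
    have "pd_s k x y = pd_s (pd_s T) x y \<bullet> N x y + pd_s T x y \<bullet> pd_s N x y"
      if "smooth_on I J N" "\<And>x'. x' \<in> I \<Longrightarrow> k x' y = pd_s T x' y \<bullet> N x' y" for k :: "real \<Rightarrow> real \<Rightarrow> real" and N :: "real \<Rightarrow> real \<Rightarrow> real^4"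
      using that \<open>x \<in> I\<close> \<open>y \<in> J\<close> smooth_frame(1)
      by (intro pd_s_eqI[OF open_I, where g = "\<lambda>x. pd_s T x y \<bullet> N x y"] has_vector_derivative_inner
          smooth_on_has_vector_derivative smooth_on_pd) auto
    note this[of P1 k1] this[of P2 k2] this[of P3 k3]
    then show "pd_s k1 x y = pd_s (pd_s T) x y \<bullet> P1 x y" "pd_s k2 x y = pd_s (pd_s T) x y \<bullet> P2 x y"
      "pd_s k3 x y = pd_s (pd_s T) x y \<bullet> P3 x y"
      using that by (simp_all add: smooth_frame k P_s, simp_all add: T_s inner_add_left ip)
  qed
  have V: "T x y \<bullet> pd_t \<Psi> x y = 0" "P1 x y \<bullet> pd_t \<Psi> x y = P x y"
    "P2 x y \<bullet> pd_t \<Psi> x y = R x y" "P3 x y \<bullet> pd_t \<Psi> x y = S x y"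
    if "x \<in> I" "y \<in> J" for x y
  proof -
    note xy = that
    have BDR: "pd_t \<Psi> x y = ternary_product (T x y) (pd_s T x y) (pd_s (pd_s T) x y)"
      using betchov_da_rios[OF xy] by (simp only: \<Psi>_ss[OF xy] \<Psi>_sss[OF xy] T[OF xy])
    have z: "pd_s (pd_s T) x y = (pd_s (pd_s T) x y \<bullet> T x y) *\<^sub>R T x y +
        pd_s k1 x y *\<^sub>R P1 x y + pd_s k2 x y *\<^sub>R P2 x y + pd_s k3 x y *\<^sub>R P3 x y"
      unfolding k_s[OF xy] by (rule orthonormal_expand_4[OF norms[OF xy] orth[OF xy]])
    note tern = inner_ternary_product_frame[OF norms[OF xy] orth[OF xy] pos[OF xy] T_s[OF xy] z]
    show "T x y \<bullet> pd_t \<Psi> x y = 0" "P1 x y \<bullet> pd_t \<Psi> x y = P x y"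
      "P2 x y \<bullet> pd_t \<Psi> x y = R x y" "P3 x y \<bullet> pd_t \<Psi> x y = S x y"
      unfolding BDR tern P R S by simp_all
  qed
  have V_expand: "pd_t \<Psi> s t = P s t *\<^sub>R P1 s t + R s t *\<^sub>R P2 s t + S s t *\<^sub>R P3 s t"
    using orthonormal_expand_4[OF norms[OF st] orth[OF st], of "pd_t \<Psi> s t"] V[OF st]
    by (simp add: inner_commute)
  \<comment> \<open>Up to sign a determinant with the row \<open>(k1, k2, k3)\<close> repeated;
    geometrically, the velocity is orthogonal to \<open>pd_s T\<close>.\<close>
  have kV: "k1 x y * P x y + k2 x y * R x y + k3 x y * S x y = 0" for x y
    unfolding P R S by algebra

  \<comment> \<open>Derivatives in \<open>t\<close> of the frame, the curvatures and the
    velocity\<close>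
  have dt: "((\<lambda>y. f s y) has_vector_derivative pd_t f s t) (at t)"
    if "smooth_on I J f" for f :: "real \<Rightarrow> real \<Rightarrow> real^4"
    using smooth_on_has_vector_derivative(2)[OF that st] .
  have ds: "((\<lambda>x. f x t) has_vector_derivative pd_s f s t) (at s)"
    if "smooth_on I J f" for f :: "real \<Rightarrow> real \<Rightarrow> real^4"
    using smooth_on_has_vector_derivative(1)[OF that st] .
  have const_t: "pd_t f s t \<bullet> g s t = - (f s t \<bullet> pd_t g s t)"
    if "smooth_on I J f" "smooth_on I J g" "\<And>y. y \<in> J \<Longrightarrow> f s y \<bullet> g s y = c" for f g :: "real \<Rightarrow> real \<Rightarrow> real^4" and c
    using has_vector_derivative_locally_const[OF open_J st(2) that(3)
        has_vector_derivative_inner[OF dt[OF that(1)] dt[OF that(2)]]] by simp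
  have const_s: "pd_s f s t \<bullet> g s t = - (f s t \<bullet> pd_s g s t)"
    if "smooth_on I J f" "smooth_on I J g" "\<And>x. x \<in> I \<Longrightarrow> f x t \<bullet> g x t = c" for f g :: "real \<Rightarrow> real \<Rightarrow> real^4" and c
    using has_vector_derivative_locally_const[OF open_I st(1) that(3)
        has_vector_derivative_inner[OF ds[OF that(1)] ds[OF that(2)]]] by simp

  \<comment> \<open>Skew symmetry of the connection coefficients in \<open>t\<close>. Those
    involving \<open>T\<close> do not enter, because the velocity has no \<open>T\<close>
    component.\<close>
  have ip_t: "P1 s t \<bullet> pd_t P1 s t = 0" "P2 s t \<bullet> pd_t P2 s t = 0" "P3 s t \<bullet> pd_t P3 s t = 0"
    "P2 s t \<bullet> pd_t P1 s t = a23 s t" "P3 s t \<bullet> pd_t P1 s t = a24 s t" "P3 s t \<bullet> pd_t P2 s t = a34 s t"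
    "P1 s t \<bullet> pd_t P2 s t = - a23 s t" "P1 s t \<bullet> pd_t P3 s t = - a24 s t" "P2 s t \<bullet> pd_t P3 s t = - a34 s t"
    using const_t[OF smooth_frame(2,2) ip(2)[OF st(1)]] const_t[OF smooth_frame(3,3) ip(3)[OF st(1)]]
      const_t[OF smooth_frame(4,4) ip(4)[OF st(1)]] const_t[OF smooth_frame(2,3) ip(11)[OF st(1)]]
      const_t[OF smooth_frame(2,4) ip(12)[OF st(1)]] const_t[OF smooth_frame(3,4) ip(13)[OF st(1)]]
    by (simp_all add: a23 a24 a34 inner_commute)

  have smooth_t: "smooth_on I J (pd_t \<Psi>)"
    using smooth by (rule smooth_on_pd)
  have dt_component: "((\<lambda>y. p s y) has_vector_derivative pd_t N s t \<bullet> pd_t \<Psi> s t + N s t \<bullet> pd_t (pd_t \<Psi>) s t) (at t)"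
    if "smooth_on I J N" "\<And>y. y \<in> J \<Longrightarrow> N s y \<bullet> pd_t \<Psi> s y = p s y" for N :: "real \<Rightarrow> real \<Rightarrow> real^4" and p :: "real \<Rightarrow> real \<Rightarrow> real"
    by (rule has_vector_derivative_transform_within_open[OF
          has_vector_derivative_inner[OF dt[OF that(1)] dt[OF smooth_t]] open_J st(2) that(2)])
  have PRS_dt:
    "((\<lambda>y. P s y) has_vector_derivative pd_t P1 s t \<bullet> pd_t \<Psi> s t + P1 s t \<bullet> pd_t (pd_t \<Psi>) s t) (at t)"
    "((\<lambda>y. R s y) has_vector_derivative pd_t P2 s t \<bullet> pd_t \<Psi> s t + P2 s t \<bullet> pd_t (pd_t \<Psi>) s t) (at t)"
    "((\<lambda>y. S s y) has_vector_derivative pd_t P3 s t \<bullet> pd_t \<Psi> s t + P3 s t \<bullet> pd_t (pd_t \<Psi>) s t) (at t)"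
    by (rule dt_component; simp add: smooth_frame V st)+
  have PRS_t: "pd_t P s t = pd_t P1 s t \<bullet> pd_t \<Psi> s t + P1 s t \<bullet> pd_t (pd_t \<Psi>) s t"
    "pd_t R s t = pd_t P2 s t \<bullet> pd_t \<Psi> s t + P2 s t \<bullet> pd_t (pd_t \<Psi>) s t"
    "pd_t S s t = pd_t P3 s t \<bullet> pd_t \<Psi> s t + P3 s t \<bullet> pd_t (pd_t \<Psi>) s t"
    unfolding pd_t_def[of P] pd_t_def[of R] pd_t_def[of S]
    by (rule PRS_dt[THEN vector_derivative_at])+
  have dt_curvature: "((\<lambda>y. k s y) has_vector_derivative pd_t k s t) (at t)"
    if "smooth_on I J N" "\<And>y. y \<in> J \<Longrightarrow> k s y = pd_s T s y \<bullet> N s y" for k :: "real \<Rightarrow> real \<Rightarrow> real" and N :: "real \<Rightarrow> real \<Rightarrow> real^4"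
  proof -
    have "((\<lambda>y. k s y) has_vector_derivative pd_t (pd_s T) s t \<bullet> N s t + pd_s T s t \<bullet> pd_t N s t) (at t)"
      by (rule has_vector_derivative_transform_within_open[OF
            has_vector_derivative_inner[OF dt[OF smooth_on_pd(1)[OF smooth_frame(1)]] dt[OF that(1)]]
            open_J st(2)]) (simp add: that)
    then show ?thesis
      unfolding pd_t_def[of k] by (metis vector_derivative_at)
  qed
  have k_dt: "((\<lambda>y. k1 s y) has_vector_derivative pd_t k1 s t) (at t)"
    "((\<lambda>y. k2 s y) has_vector_derivative pd_t k2 s t) (at t)"
    "((\<lambda>y. k3 s y) has_vector_derivative pd_t k3 s t) (at t)"
    using dt_curvature[of P1 k1] dt_curvature[of P2 k2] dt_curvature[of P3 k3]
    by (simp_all add: smooth_frame k st)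
  \<comment> \<open>Pairing the acceleration with \<open>pd_s T\<close> produces
    \<open>t\<close>-derivatives of \<open>P\<close>, \<open>R\<close>, \<open>S\<close>; this
    relation trades them for the derivatives of the curvatures that occur in
    \<open>A\<close>.\<close>
  have kV_t: "pd_t k1 s t * P s t + k1 s t * pd_t P s t + pd_t k2 s t * R s t + k2 s t * pd_t R s t +
      pd_t k3 s t * S s t + k3 s t * pd_t S s t = 0"
    using has_vector_derivative_locally_const[where
        f = "\<lambda>y. k1 s y * P s y + k2 s y * R s y + k3 s y * S s y", OF open_J st(2) kV
        has_vector_derivative_add[OF has_vector_derivative_add[OF
          has_vector_derivative_mult[OF k_dt(1) PRS_dt(1)]
          has_vector_derivative_mult[OF k_dt(2) PRS_dt(2)]]
          has_vector_derivative_mult[OF k_dt(3) PRS_dt(3)]]]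
    unfolding PRS_t by simp
  have \<Psi>_tt: "pd_t (pd_t \<Psi>) s t \<bullet> P1 s t = pd_t P s t - R s t * a23 s t - S s t * a24 s t"
    "pd_t (pd_t \<Psi>) s t \<bullet> P2 s t = pd_t R s t + P s t * a23 s t - S s t * a34 s t"
    "pd_t (pd_t \<Psi>) s t \<bullet> P3 s t = pd_t S s t + P s t * a24 s t + R s t * a34 s t"
    unfolding PRS_t V_expand
    by (simp_all add: inner_add_right inner_commute[of "pd_t P1 s t"] inner_commute[of "pd_t P2 s t"]
        inner_commute[of "pd_t P3 s t"] ip_t, simp_all add: inner_commute)

  \<comment> \<open>The orthogonal normal frame \<open>K\<close>, \<open>n\<close>\<close>
  define K where "K = pd_s T s t"
  define n where "n = (S s t * k2 s t - R s t * k3 s t) *\<^sub>R P1 s t +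
    (- S s t * k1 s t + P s t * k3 s t) *\<^sub>R P2 s t + (R s t * k1 s t - P s t * k2 s t) *\<^sub>R P3 s t"
  define X where "X = K + (1 / (W s t)\<^sup>2) *\<^sub>R pd_t (pd_t \<Psi>) s t"
  have Q2: "(Q s t)\<^sup>2 = (k1 s t)\<^sup>2 + (k2 s t)\<^sup>2 + (k3 s t)\<^sup>2"
    by (simp add: Q)
  have W2: "(W s t)\<^sup>2 = (P s t)\<^sup>2 + (R s t)\<^sup>2 + (S s t)\<^sup>2"
    by (simp add: W)
  have W_nz: "(W s t)\<^sup>2 \<noteq> 0"
    using PRS[OF st] unfolding W2 by (simp add: add_nonneg_eq_0_iff)
  have Q_nz: "(Q s t)\<^sup>2 \<noteq> 0"
  proof
    assume "(Q s t)\<^sup>2 = 0"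
    then have "k1 s t = 0" "k2 s t = 0" "k3 s t = 0"
      unfolding Q2 by (simp_all add: add_nonneg_eq_0_iff)
    then show False
      using PRS[OF st] by (simp add: P R S)
  qed
  note kV = kV[of s t]
  have KK: "K \<bullet> K = (Q s t)\<^sup>2"
    unfolding K_def T_s[OF st] Q2 by (simp add: inner_add_left inner_add_right ip[OF st] power2_eq_square)
  have VV: "pd_t \<Psi> s t \<bullet> pd_t \<Psi> s t = (W s t)\<^sup>2"
    unfolding V_expand W2 by (simp add: inner_add_left inner_add_right ip[OF st] power2_eq_square)
  have nn: "n \<bullet> n = (Q s t)\<^sup>2 * (W s t)\<^sup>2"
  proof -
    have "n \<bullet> n = (S s t * k2 s t - R s t * k3 s t)\<^sup>2 + (- S s t * k1 s t + P s t * k3 s t)\<^sup>2 +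
        (R s t * k1 s t - P s t * k2 s t)\<^sup>2"
      unfolding n_def by (simp add: inner_add_left inner_add_right ip[OF st] power2_eq_square)
    \<comment> \<open>Lagrange's identity for the cross product; its mixed term is the square of the
      left side of \<open>kV\<close> and vanishes.\<close>
    also have "\<dots> = (Q s t)\<^sup>2 * (W s t)\<^sup>2"
      unfolding Q2 W2 using kV by algebra
    finally show ?thesis .
  qed
  have KV: "K \<bullet> pd_t \<Psi> s t = 0"
    unfolding K_def T_s[OF st] V_expand using kV by (simp add: inner_add_left inner_add_right ip[OF st] mult.commute)
  have nK: "K \<bullet> n = 0"
    unfolding K_def T_s[OF st] n_def
    by (simp add: inner_add_left inner_add_right ip[OF st]) algebra
  have nV: "pd_t \<Psi> s t \<bullet> n = 0"
    unfolding V_expand n_def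
    by (simp add: inner_add_left inner_add_right ip[OF st]) algebra
  have TK: "T s t \<bullet> K = 0" and Tn: "T s t \<bullet> n = 0"
    unfolding K_def T_s[OF st] n_def by (simp_all add: inner_add_right ip[OF st])
  have \<Psi>_tt_K: "pd_t (pd_t \<Psi>) s t \<bullet> K = A s t"
    unfolding K_def T_s[OF st] A using kV_t
    by (simp add: inner_add_right \<Psi>_tt) algebra
  \<comment> \<open>The coefficient of \<open>a34\<close> is
    \<open>k1 (R^2 + S^2) - P (k2 R + k3 S)\<close>, which \<open>kV\<close> turns into
    \<open>k1 W^2\<close>; those of \<open>a23\<close> and \<open>a24\<close> collapse in the same
    way.\<close>
  have \<Psi>_tt_n: "pd_t (pd_t \<Psi>) s t \<bullet> n = B s t"
    unfolding n_def B W2 inner_add_right inner_scaleR_right \<Psi>_tt using kV by algebra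

  \<comment> \<open>Shape operators and the mean curvature vector\<close>
  have normal: "norm (N1 x y) = 1" "norm (N2 x y) = 1" "orthogonal (N1 x y) (N2 x y)"
    "N1 x y \<bullet> pd_s \<Psi> x y = 0" "N2 x y \<bullet> pd_s \<Psi> x y = 0"
    "N1 x y \<bullet> pd_t \<Psi> x y = 0" "N2 x y \<bullet> pd_t \<Psi> x y = 0"
    if "x \<in> I" "y \<in> J" for x y
    using normal_frame that
    by (auto simp: orthonormal_normal_frame_def tangent_plane_def orthogonal_def span_base)
  have smooth_N: "smooth_on I J N1" "smooth_on I J N2"
    using normal_frame by (auto simp: orthonormal_normal_frame_def)
  have trace: "trace_on (tangent_plane \<Psi> s t) (shape_operator \<Psi> N s t) = X \<bullet> N s t"
    if N: "smooth_on I J N" "\<And>x. x \<in> I \<Longrightarrow> N x t \<bullet> pd_s \<Psi> x t = 0"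
      "\<And>y. y \<in> J \<Longrightarrow> N s y \<bullet> pd_t \<Psi> s y = 0" for N :: "real \<Rightarrow> real \<Rightarrow> real^4"
  proof -
    have "trace_on (tangent_plane \<Psi> s t) (shape_operator \<Psi> N s t) =
        - (pd_s N s t \<bullet> pd_s \<Psi> s t) / (pd_s \<Psi> s t \<bullet> pd_s \<Psi> s t)
        - (pd_t N s t \<bullet> pd_t \<Psi> s t) / (pd_t \<Psi> s t \<bullet> pd_t \<Psi> s t)"
      using unit_speed[OF st] VV W_nz V(1)[OF st]
      by (intro trace_shape_operator) (auto simp: orthogonal_def T[OF st])
    also have "\<dots> = X \<bullet> N s t"
      using const_s[OF N(1) smooth_on_pd(1)[OF smooth] N(2)] const_t[OF N(1) smooth_t N(3)] ip(1)[OF st]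
      by (simp add: VV X_def K_def \<Psi>_ss[OF st] T[OF st] inner_add_right inner_commute)
    finally show ?thesis .
  qed
  have "mean_curvature_vector \<Psi> N1 N2 s t =
      (1/2) *\<^sub>R ((X \<bullet> N1 s t) *\<^sub>R N1 s t + (X \<bullet> N2 s t) *\<^sub>R N2 s t)"
    unfolding mean_curvature_vector_def
    by (simp add: trace smooth_N normal st)
  also have "(X \<bullet> N1 s t) *\<^sub>R N1 s t + (X \<bullet> N2 s t) *\<^sub>R N2 s t =
      ((X \<bullet> K) / (K \<bullet> K)) *\<^sub>R K + ((X \<bullet> n) / (n \<bullet> n)) *\<^sub>R n"
  proof (rule projection_orthogonal_complement[of "T s t" "pd_t \<Psi> s t"])
    show "T s t \<noteq> 0"
      using norms(1)[OF st] by auto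
    show "pd_t \<Psi> s t \<noteq> 0" "K \<noteq> 0" "n \<noteq> 0"
      using VV KK nn Q_nz W_nz by auto
  qed (use normal[OF st] V(1)[OF st] KV nK nV TK Tn in
      \<open>simp_all add: orthogonal_def T[OF st] inner_commute\<close>)
  also have "(1/2) *\<^sub>R \<dots> =
      (1 / (2 * (Q s t)\<^sup>2 * (W s t)^4)) *\<^sub>R
        (B s t *\<^sub>R n + ((W s t)\<^sup>2 * ((Q s t)\<^sup>2 * (W s t)\<^sup>2 + A s t)) *\<^sub>R K)"
  proof -
    have "X \<bullet> K = (Q s t)\<^sup>2 + A s t / (W s t)\<^sup>2" "X \<bullet> n = B s t / (W s t)\<^sup>2"
      by (simp_all add: X_def inner_add_left KK nK \<Psi>_tt_K \<Psi>_tt_n)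
    moreover have "(W s t)^4 = (W s t)\<^sup>2 * (W s t)\<^sup>2"
      by simp
    \<comment> \<open>Here \<open>q\<close>, \<open>w\<close>, \<open>a\<close>, \<open>b\<close>
      stand for \<open>Q^2\<close>, \<open>W^2\<close>, \<open>A\<close>, \<open>B\<close>; both
      coefficients are brought to the common denominator \<open>2 Q^2 W^4\<close>.\<close>
    moreover have "1/2 * ((q + a / w) / q) = 1 / (2 * q * (w * w)) * (w * (q * w + a))"
      "1/2 * ((b / w) / (q * w)) = 1 / (2 * q * (w * w)) * b"
      if "q \<noteq> 0" "w \<noteq> 0" for q w a b :: real
      using that by (simp_all add: field_simps)
    note this[OF Q_nz W_nz]
    ultimately show ?thesis
      unfolding KK nn scaleR_add_right scaleR_scaleR by (simp only: add.commute)
  qed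
  finally show "mean_curvature_vector \<Psi> N1 N2 s t =
    (1 / (2 * (Q s t)^2 * (W s t)^4)) *\<^sub>R
      (((S s t * k2 s t - R s t * k3 s t) * B s t +
          (W s t)^2 * k1 s t * ((Q s t)^2 * (W s t)^2 + A s t)) *\<^sub>R P1 s t +
       ((- S s t * k1 s t + P s t * k3 s t) * B s t +
          (W s t)^2 * k2 s t * ((Q s t)^2 * (W s t)^2 + A s t)) *\<^sub>R P2 s t +
       ((R s t * k1 s t - P s t * k2 s t) * B s t +
          (W s t)^2 * k3 s t * ((Q s t)^2 * (W s t)^2 + A s t)) *\<^sub>R P3 s t)"
    unfolding K_def T_s[OF st] n_def
    by (simp only: scaleR_add_left scaleR_add_right scaleR_scaleR distrib_right distrib_left mult_ac add_ac)
qed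

end
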